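(* Let $G_n$ ($n\ge1$) be the linear crossed polyomino chain with $n$ four-order complete graphs. Then the number of spanning trees of $G_n$ is $$\tau(G_n)=2^{2n+2}\cdot 3^{n-1}.$$
   Context: For $n\geq1$, $G_n$ is the simple graph with vertex set $\{1,\ldots,n+1\}\cup\{1',\ldots,(n+1)'\}$ and edge set consisting of the vertical edges $ii'$ for $1\le i\le n+1$ together with, for each $1\le i\le n$, the edges $i(i+1)$, $i'(i+1)'$, $i(i+1)'$, $i'(i+1)$. $\tau(G)$ denotes the number of spanning trees of $G$. *)

theory Defs
  imports "Graph_Theory.Graph_Theory"
begin

text \<open>
  As usual in \<^theory>\<open>Graph_Theory.Digraph\<close>, an undirected simple graph is a symmetric digraph
  (\<^locale>\<open>pair_graph\<close>): the edge \<open>uv\<close> is the pair of arcs \<open>(u, v)\<close>, \<open>(v, u)\<close>.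

  The library constants \<^const>\<open>forest\<close>, \<^const>\<open>tree\<close> and \<^const>\<open>spanning_tree\<close> exclude every
  directed cycle, hence also the closed walk \<open>u, v, u\<close>, so they hold of no symmetric digraph
  that has an arc. In a symmetric digraph the cycles of the underlying simple graph are the
  directed cycles of length at least 3, and only these are excluded below.
\<close>

definition undirected_forest :: "'a pair_pre_digraph \<Rightarrow> bool" where
  "undirected_forest H \<longleftrightarrow> pair_graph H \<and>
     \<not> (\<exists>p. pre_digraph.cycle (with_proj H) p \<and> 3 \<le> length p)"

definition undirected_tree :: "'a pair_pre_digraph \<Rightarrow> bool" where
  "undirected_tree H \<longleftrightarrow> connected (with_proj H) \<and> undirected_forest H"

definition undirected_spanning_tree :: "'a pair_pre_digraph \<Rightarrow> 'a pair_pre_digraph \<Rightarrow> bool" where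
  "undirected_spanning_tree H G \<longleftrightarrow>
     undirected_tree H \<and> spanning (with_proj H) (with_proj G)"

definition num_spanning_trees :: "'a pair_pre_digraph \<Rightarrow> nat" (\<open>\<tau>\<close>) where
  "\<tau> G = card {H. undirected_spanning_tree H G}"

text \<open>\<open>Plain i\<close> is the vertex $i$ and \<open>Primed i\<close> the vertex $i'$.\<close>

datatype chain_vertex = Plain nat | Primed nat

definition crossed_chain :: "nat \<Rightarrow> chain_vertex pair_pre_digraph" where
  "crossed_chain n =
     \<lparr> pverts = Plain ` {1..n+1} \<union> Primed ` {1..n+1},
       parcs =
         symcl ((\<Union>i\<in>{1..n+1}. {(Plain i, Primed i)}) \<union>
                (\<Union>i\<in>{1..n}. {(Plain i, Plain (i+1)), (Primed i, Primed (i+1)),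
                              (Plain i, Primed (i+1)), (Primed i, Plain (i+1))})) \<rparr>"

lemma pair_graph_crossed_chain: "pair_graph (crossed_chain n)"
  by unfold_locales
    (auto simp: crossed_chain_def symcl_def symmetric_def intro!: symI)

lemma finite_spanning_trees:
  assumes "pair_graph G"
  shows "finite {H. undirected_spanning_tree H G}"
proof -
  interpret pair_graph G by fact
  have "{H. undirected_spanning_tree H G}
          \<subseteq> (\<lambda>(V, A). \<lparr> pverts = V, parcs = A \<rparr>) ` (Pow (pverts G) \<times> Pow (parcs G))"
  proof
    fix H assume "H \<in> {H. undirected_spanning_tree H G}"
    then have "(pverts H, parcs H) \<in> Pow (pverts G) \<times> Pow (parcs G)"
      by (auto simp: undirected_spanning_tree_def spanning_def subgraph_def)
    then show "H \<in> (\<lambda>(V, A). \<lparr> pverts = V, parcs = A \<rparr>) ` (Pow (pverts G) \<times> Pow (parcs G))"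
      by (intro image_eqI) auto
  qed
  then show ?thesis
    by (rule finite_subset) (simp add: pair_finite_verts pair_finite_arcs)
qed

end

(* A subforest of the chain in which every vertex is joined to one of the two last vertices
   x = n+1 and x' = (n+1)' either joins x to x' ("linked", a spanning tree) or does not
   ("unlinked"). Restricting such a forest of the next chain to the old edges gives one of the
   same kind, and which sets of the five new edges extend a given forest depends only on whether
   it is linked. Enumerating the 32 sets of new edges gives, for the numbers T and F of linked and
   unlinked forests, T' = 8 T + 8 F and F' = 4 T + 4 F, starting from T = F = 1. *)

theory Submission
  imports Defs
begin

section \<open>Connectivity and acyclicity of edge sets with undirected meaning\<close>

definition conn :: "'a rel \<Rightarrow> 'a \<Rightarrow> 'a \<Rightarrow> bool" where
  "conn A u v \<longleftrightarrow> (u, v) \<in> (symcl A)\<^sup>*"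

text \<open>Acyclicity as "every edge is a bridge". It fits sets that hold each edge in one
  orientation only: if \<open>(v, u)\<close> were present as well, it would reconnect the ends of a
  deleted \<open>(u, v)\<close>.\<close>

definition acyc :: "'a rel \<Rightarrow> bool" where
  "acyc A \<longleftrightarrow> (\<forall>(u, v)\<in>A. \<not> conn (A - {(u, v)}) u v)"

lemma symcl_iff: "(u, v) \<in> symcl A \<longleftrightarrow> (u, v) \<in> A \<or> (v, u) \<in> A"
  by (force simp: symcl_def)

lemma sym_symcl: "sym (symcl A)"
  by (simp add: sym_def symcl_iff disj_commute)

lemma symcl_mono: "A \<subseteq> B \<Longrightarrow> symcl A \<subseteq> symcl B"
  by (auto simp: symcl_def)

lemma conn_refl [simp]: "conn A u u"
  by (simp add: conn_def)

lemma conn_sym: "conn A u v \<Longrightarrow> conn A v u"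
  unfolding conn_def by (metis sym_rtrancl sym_symcl symD)

lemma conn_commute: "conn A u v \<longleftrightarrow> conn A v u"
  by (blast intro: conn_sym)

lemma conn_trans: "conn A u v \<Longrightarrow> conn A v w \<Longrightarrow> conn A u w"
  unfolding conn_def by (rule rtrancl_trans)

lemma conn_mono: "A \<subseteq> B \<Longrightarrow> conn A u v \<Longrightarrow> conn B u v"
  unfolding conn_def using rtrancl_mono[OF symcl_mono] by blast

lemma conn_edge: "(u, v) \<in> A \<Longrightarrow> conn A u v"
  by (simp add: conn_def symcl_iff r_into_rtrancl)

lemma conn_induct [consumes 1, case_names base step]:
  assumes "conn A u v" "P u"
    and "\<And>v w. conn A u v \<Longrightarrow> (v, w) \<in> A \<or> (w, v) \<in> A \<Longrightarrow> P v \<Longrightarrow> P w"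
  shows "P v"
  using assms(1)[unfolded conn_def]
  by (induction rule: rtrancl_induct) (use assms(2,3) in \<open>auto simp: conn_def symcl_iff\<close>)

text \<open>A shortest walk crosses the new edge at most once, in one of its two directions. As a
  rewrite rule this reduces connectivity after adding explicit edges to connectivity in
  \<open>A\<close>.\<close>

lemma conn_insert:
  "conn (insert (p, q) A) u v \<longleftrightarrow>
     conn A u v \<or> conn A u p \<and> conn A q v \<or> conn A u q \<and> conn A p v"
proof
  assume "conn (insert (p, q) A) u v"
  then show "conn A u v \<or> conn A u p \<and> conn A q v \<or> conn A u q \<and> conn A p v"
  proof (induction rule: conn_induct)
    case (step v w)
    then consider "conn A v w" | "v = p" "w = q" | "v = q" "w = p"
      by (auto intro: conn_edge conn_sym)
    then show ?case
      by cases (use step.IH in \<open>auto intro: conn_trans\<close>)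
  qed simp
next
  have pq: "conn (insert (p, q) A) p q" by (simp add: conn_edge)
  have A: "conn (insert (p, q) A) s t" if "conn A s t" for s t
    using that by (rule conn_mono[rotated]) blast
  assume "conn A u v \<or> conn A u p \<and> conn A q v \<or> conn A u q \<and> conn A p v"
  then show "conn (insert (p, q) A) u v"
    using A pq conn_sym[OF pq] by (blast intro: conn_trans)
qed

lemma conn_isolated:
  assumes "v \<notin> Field A"
  shows "conn A u v \<longleftrightarrow> u = v"
proof
  assume "conn A u v"
  then have "conn A v u" by (rule conn_sym)
  then show "u = v"
    by (induction rule: conn_induct) (use assms in \<open>auto simp: Field_def\<close>)
qed simp

text \<open>A new edge closes a cycle exactly when its ends were joined before.\<close>

lemma acyc_insert:
  assumes "(p, q) \<notin> A"
  shows "acyc (insert (p, q) A) \<longleftrightarrow> acyc A \<and> \<not> conn A p q"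
proof -
  have del: "insert (p, q) A - {(u, v)} = insert (p, q) (A - {(u, v)})" if "(u, v) \<in> A" for u v
    using that assms by auto
  have cA: "conn A p q \<longleftrightarrow> conn (A - {(u, v)}) p q \<or>
      conn (A - {(u, v)}) p u \<and> conn (A - {(u, v)}) v q \<or>
      conn (A - {(u, v)}) p v \<and> conn (A - {(u, v)}) u q" if "(u, v) \<in> A" for u v
    using conn_insert[of u v "A - {(u, v)}" p q] that by (simp add: insert_absorb)
  show ?thesis
  proof
    assume L: "acyc (insert (p, q) A)"
    have "\<not> conn A p q"
      using bspec[OF L[unfolded acyc_def], of "(p, q)"] assms by simp
    moreover have "acyc A"
      using L unfolding acyc_def by (auto simp: del conn_insert)
    ultimately show "acyc A \<and> \<not> conn A p q" by blast
  next
    assume R: "acyc A \<and> \<not> conn A p q"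
    \<comment> \<open>For an old edge \<open>(u, v)\<close>, a detour from \<open>u\<close> to
      \<open>v\<close> must cross \<open>(p, q)\<close>. The rest of the detour together with
      \<open>(u, v)\<close> then joins \<open>p\<close> to \<open>q\<close> inside \<open>A\<close>,
      which \<open>cA\<close> makes precise.\<close>
    have "\<not> conn (insert (p, q) A - {(u, v)}) u v" if "(u, v) \<in> insert (p, q) A" for u v
    proof (cases "(u, v) = (p, q)")
      case True
      then show ?thesis using R assms by simp
    next
      case False
      then have uv: "(u, v) \<in> A" using that by auto
      then have "\<not> conn (A - {(u, v)}) u v" using R by (auto simp: acyc_def)
      then show ?thesis
        using R cA[OF uv] unfolding del[OF uv] conn_insert by (metis conn_sym)
    qed
    then show "acyc (insert (p, q) A)" unfolding acyc_def by blast
  qed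
qed

lemma acyc_empty [simp]: "acyc {}"
  by (simp add: acyc_def)

lemma acyc_mono:
  assumes "acyc B" "A \<subseteq> B"
  shows "acyc A"
  using assms unfolding acyc_def
  by (blast dest: conn_mono[rotated, of _ _ _ "B - _"])

section \<open>Two-rooted forests and their extensions by two vertices and five edges\<close>

definition covering :: "'a set \<Rightarrow> 'a \<Rightarrow> 'a \<Rightarrow> 'a rel \<Rightarrow> bool" where
  "covering V x y A \<longleftrightarrow> (\<forall>v\<in>V. conn A v x \<or> conn A v y)"

text \<open>Splits the subsets by whether they contain \<open>e\<close>; repeated five times, it
  unrolls a sum over all sets of new edges into 32 terms.\<close>

lemma sum_Pow_insert:
  assumes "finite X" "e \<notin> X"
  shows "(\<Sum>A\<in>Pow (insert e X). f A) = (\<Sum>A\<in>Pow X. f A + f (insert e A))"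
proof -
  have "inj_on (insert e) (Pow X)"
    using assms(2) by (auto simp: inj_on_def)
  then show ?thesis
    using assms unfolding Pow_insert
    by (subst sum.union_disjoint) (auto simp: sum.reindex sum.distrib)
qed

lemma card_filter_eq_sum: "finite X \<Longrightarrow> card {A \<in> X. P A} = (\<Sum>A\<in>X. of_bool (P A))"
  by (simp add: of_bool_def sum.If_cases Int_def)

text \<open>The new edges meet \<open>V\<close> only in \<open>x\<close> and \<open>y\<close>, so an
  old component containing neither can never reach \<open>a\<close> or \<open>b\<close>. Once every
  old component contains a root, only the fate of the two roots matters.\<close>

lemma covering_step:
  assumes V: "x \<in> V" "y \<in> V" "a \<notin> V" "b \<notin> V" and A: "A \<subseteq> V \<times> V"
    and S: "S \<subseteq> {(x, a), (x, b), (y, a), (y, b), (a, b)}"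
  shows "covering (insert a (insert b V)) a b (A \<union> S) \<longleftrightarrow>
    covering V x y A \<and> covering {x, y} a b (A \<union> S)"
proof
  assume L: "covering (insert a (insert b V)) a b (A \<union> S)"
  \<comment> \<open>Invariant along a walk from \<open>v\<close>: either it is still in
    \<open>V\<close> and has used only edges of \<open>A\<close>, or \<open>v\<close> is already
    known to be joined in \<open>A\<close> to a root. A new edge can be entered from
    \<open>V\<close> only at a root.\<close>
  have *: "w \<in> V \<and> conn A v w \<or> conn A v x \<or> conn A v y"
    if "conn (A \<union> S) v w" "v \<in> V" for v w
    using that(1)
  proof (induction rule: conn_induct)
    case (step w z)
    show ?case
    proof (cases "conn A v x \<or> conn A v y")
      case False
      then have "w \<in> V" "w \<noteq> x" "w \<noteq> y" "conn A v w" using step.IH by auto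
      then have "(w, z) \<in> A \<or> (z, w) \<in> A" using step.hyps(2) V S by auto
      then have "z \<in> V" "conn A w z" using A by (auto intro: conn_edge conn_sym)
      then show ?thesis using \<open>conn A v w\<close> conn_trans by metis
    qed auto
  qed (use that in simp)
  then have "covering V x y A"
    using L V unfolding covering_def by (metis insertCI)
  then show "covering V x y A \<and> covering {x, y} a b (A \<union> S)"
    using L V by (auto simp: covering_def)
next
  assume R: "covering V x y A \<and> covering {x, y} a b (A \<union> S)"
  have "conn (A \<union> S) v a \<or> conn (A \<union> S) v b" if "v \<in> V" for v
  proof -
    have "conn (A \<union> S) v x \<or> conn (A \<union> S) v y"
      using R that unfolding covering_def by (meson conn_mono sup_ge1)
    then show ?thesis
      using R unfolding covering_def by (auto intro: conn_trans)
  qed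
  then show "covering (insert a (insert b V)) a b (A \<union> S)"
    by (auto simp: covering_def)
qed

definition linked :: "'a set \<Rightarrow> 'a \<Rightarrow> 'a \<Rightarrow> 'a rel \<Rightarrow> bool" where
  "linked V x y A \<longleftrightarrow> acyc A \<and> covering V x y A \<and> conn A x y"

definition unlinked :: "'a set \<Rightarrow> 'a \<Rightarrow> 'a \<Rightarrow> 'a rel \<Rightarrow> bool" where
  "unlinked V x y A \<longleftrightarrow> acyc A \<and> covering V x y A \<and> \<not> conn A x y"

lemma
  fixes E :: "'a rel"
  assumes V: "x \<in> V" "y \<in> V" "a \<notin> V" "b \<notin> V" "x \<noteq> y" "a \<noteq> b" and E: "E \<subseteq> V \<times> V" "finite E"
  defines "E' \<equiv> insert (x, a) (insert (x, b) (insert (y, a) (insert (y, b) (insert (a, b) E))))"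
    and "V' \<equiv> insert a (insert b V)"
  shows card_linked_step: "card {B \<in> Pow E'. linked V' a b B} =
      8 * card {A \<in> Pow E. linked V x y A} + 8 * card {A \<in> Pow E. unlinked V x y A}" (is ?L)
    and card_unlinked_step: "card {B \<in> Pow E'. unlinked V' a b B} =
      4 * card {A \<in> Pow E. linked V x y A} + 4 * card {A \<in> Pow E. unlinked V x y A}" (is ?S)
proof -
  have ne: "x \<noteq> a" "x \<noteq> b" "y \<noteq> a" "y \<noteq> b" using V by auto
  have notE: "(x, a) \<notin> E" "(x, b) \<notin> E" "(y, a) \<notin> E" "(y, b) \<notin> E" "(a, b) \<notin> E"
    using V E by auto
  have fin: "finite E'" using E by (simp add: E'_def)
  let ?N = "{(x, a), (x, b), (y, a), (y, b), (a, b)}"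
  \<comment> \<open>Every set of edges of the larger graph splits uniquely into an old part
    \<open>A\<close> and a new part \<open>S\<close>.\<close>
  have sumE': "(\<Sum>B\<in>Pow E'. f B) = (\<Sum>A\<in>Pow E. \<Sum>S\<in>Pow ?N. f (A \<union> S))"
    for f :: "'a rel \<Rightarrow> nat"
    unfolding E'_def using V(5,6) ne ne[symmetric] notE E(2)
    by (simp add: sum_Pow_insert sum.distrib Un_insert_right)
  \<comment> \<open>The number of extensions of one fixed \<open>A\<close>. At most one of the two
    indicators on the right is nonzero.\<close>
  have counts:
    "(\<Sum>S\<in>Pow ?N. of_bool (linked V' a b (A \<union> S))) =
       8 * of_bool (linked V x y A) + (8 * of_bool (unlinked V x y A) :: nat) \<and>
     (\<Sum>S\<in>Pow ?N. of_bool (unlinked V' a b (A \<union> S))) =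
       4 * of_bool (linked V x y A) + (4 * of_bool (unlinked V x y A) :: nat)"
    if "A \<subseteq> E" for A
  proof -
    have A: "A \<subseteq> V \<times> V" and notA: "(x, a) \<notin> A" "(x, b) \<notin> A" "(y, a) \<notin> A" "(y, b) \<notin> A" "(a, b) \<notin> A"
      using that E(1) notE by auto
    have "a \<notin> Field A" "b \<notin> Field A" using A V by (auto simp: Field_def)
    then have iso: "conn A u a \<longleftrightarrow> u = a" "conn A a u \<longleftrightarrow> u = a"
      "conn A u b \<longleftrightarrow> u = b" "conn A b u \<longleftrightarrow> u = b" for u
      by (auto simp: conn_isolated conn_commute[of _ _ u])
    have cov: "covering V' a b (A \<union> S) \<longleftrightarrow> covering V x y A \<and> covering {x, y} a b (A \<union> S)"
      if "S \<in> Pow ?N" for S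
      unfolding V'_def using covering_step[OF V(1-4) A] that by blast
    show ?thesis
    proof (cases "acyc A \<and> covering V x y A")
      \<comment> \<open>New edges can neither destroy a cycle of \<open>A\<close> nor repair a
        failure of covering, so both sides vanish.\<close>
      case False
      then have "\<not> linked V' a b (A \<union> S)" "\<not> unlinked V' a b (A \<union> S)" if "S \<in> Pow ?N" for S
        using cov[OF that] acyc_mono[of "A \<union> S" A] by (auto simp: linked_def unlinked_def)
      then show ?thesis using False by (auto simp: linked_def unlinked_def)
    next
      case True
      define L S where "L = (\<lambda>B. acyc B \<and> covering {x, y} a b B \<and> conn B a b)"
        and "S = (\<lambda>B. acyc B \<and> covering {x, y} a b B \<and> \<not> conn B a b)"
      have LS: "(\<Sum>C\<in>Pow ?N. of_bool (linked V' a b (A \<union> C))) = (\<Sum>C\<in>Pow ?N. of_bool (L (A \<union> C)) :: nat)"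
        "(\<Sum>C\<in>Pow ?N. of_bool (unlinked V' a b (A \<union> C))) = (\<Sum>C\<in>Pow ?N. of_bool (S (A \<union> C)) :: nat)"
        using True cov by (intro sum.cong; simp add: linked_def unlinked_def L_def S_def)+
      show ?thesis
      proof (cases "conn A x y")
        case xy: True
        then have yx: "conn A y x" by (rule conn_sym)
        \<comment> \<open>Joined roots act as a single vertex \<open>z\<close>: a triangle
          \<open>z\<close>, \<open>a\<close>, \<open>b\<close> with the sides at \<open>z\<close>
          doubled has 2*2 + 2 + 2 = 8 spanning trees. Keeping \<open>a\<close> and \<open>b\<close>
          apart means choosing exactly one of the 4 edges at \<open>z\<close>.\<close>
        have "(\<Sum>C\<in>Pow ?N. of_bool (L (A \<union> C))) = (8::nat)"
          and "(\<Sum>C\<in>Pow ?N. of_bool (S (A \<union> C))) = (4::nat)"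
          using True
          by (simp_all add: sum_Pow_insert L_def S_def covering_def acyc_insert conn_insert
              notA iso xy yx ne ne[symmetric] V(5,6) V(5,6)[symmetric] del: sum_of_bool_eq)
        then show ?thesis
          using True xy unfolding LS by (simp add: linked_def unlinked_def)
      next
        case xy: False
        then have yx: "\<not> conn A y x" using conn_sym by metis
        \<comment> \<open>Separate roots: the new edges form the complete graph on \<open>x\<close>,
          \<open>y\<close>, \<open>a\<close>, \<open>b\<close> without the edge \<open>xy\<close>,
          which has 8 spanning trees. Keeping \<open>a\<close> and \<open>b\<close> apart, each of
          \<open>x\<close> and \<open>y\<close> picks exactly one of them, in 2*2 = 4 ways.\<close>
        have "(\<Sum>C\<in>Pow ?N. of_bool (L (A \<union> C))) = (8::nat)"
          and "(\<Sum>C\<in>Pow ?N. of_bool (S (A \<union> C))) = (4::nat)"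
          using True
          by (simp_all add: sum_Pow_insert L_def S_def covering_def acyc_insert conn_insert
              notA iso xy yx ne ne[symmetric] V(5,6) V(5,6)[symmetric] del: sum_of_bool_eq)
        then show ?thesis
          using True xy unfolding LS by (simp add: linked_def unlinked_def)
      qed
    qed
  qed
  show ?L ?S
    unfolding card_filter_eq_sum[OF finite_Pow_iff[THEN iffD2, OF fin]]
      card_filter_eq_sum[OF finite_Pow_iff[THEN iffD2, OF E(2)]] sumE'
    using counts by (simp_all add: sum.distrib sum_distrib_left)
qed

section \<open>The crossed chain and its recurrence\<close>

definition chain_verts :: "nat \<Rightarrow> chain_vertex set" where
  "chain_verts n = Plain ` {1..n+1} \<union> Primed ` {1..n+1}"

text \<open>One arc is kept per edge, so that subsets of this set stand for the subgraphs on all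
  vertices.\<close>

definition chain_edges :: "nat \<Rightarrow> chain_vertex rel" where
  "chain_edges n = (\<Union>i\<in>{1..n+1}. {(Plain i, Primed i)}) \<union>
     (\<Union>i\<in>{1..n}. {(Plain i, Plain (i+1)), (Primed i, Primed (i+1)),
                   (Plain i, Primed (i+1)), (Primed i, Plain (i+1))})"

lemma crossed_chain_eq: "crossed_chain n = \<lparr> pverts = chain_verts n, parcs = symcl (chain_edges n) \<rparr>"
  by (simp add: crossed_chain_def chain_verts_def chain_edges_def)

lemma finite_chain_edges: "finite (chain_edges n)"
  by (simp add: chain_edges_def)

lemma chain_edges_subset: "chain_edges n \<subseteq> chain_verts n \<times> chain_verts n"
  by (auto simp: chain_edges_def chain_verts_def)

lemma chain_edges_asym: "(u, v) \<in> chain_edges n \<Longrightarrow> (v, u) \<notin> chain_edges n"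
  by (auto simp: chain_edges_def)

lemma chain_verts_Suc:
  "chain_verts (Suc n) = insert (Plain (n+2)) (insert (Primed (n+2)) (chain_verts n))"
  by (auto simp: chain_verts_def atLeastAtMostSuc_conv)

lemma chain_edges_Suc:
  "chain_edges (Suc n) =
     insert (Plain (n+1), Plain (n+2)) (insert (Plain (n+1), Primed (n+2))
       (insert (Primed (n+1), Plain (n+2)) (insert (Primed (n+1), Primed (n+2))
         (insert (Plain (n+2), Primed (n+2)) (chain_edges n)))))"
proof -
  have "{1..Suc n + 1} = insert (n+2) {1..n+1}" "{1..Suc n} = insert (n+1) {1..n}" by auto
  then show ?thesis unfolding chain_edges_def by auto
qed

definition num_linked :: "nat \<Rightarrow> nat" where
  "num_linked n = card {A \<in> Pow (chain_edges n). linked (chain_verts n) (Plain (n+1)) (Primed (n+1)) A}"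

definition num_unlinked :: "nat \<Rightarrow> nat" where
  "num_unlinked n = card {A \<in> Pow (chain_edges n). unlinked (chain_verts n) (Plain (n+1)) (Primed (n+1)) A}"

lemma num_Suc:
  "num_linked (Suc n) = 8 * num_linked n + 8 * num_unlinked n"
  "num_unlinked (Suc n) = 4 * num_linked n + 4 * num_unlinked n"
proof -
  have "Plain (n+1) \<in> chain_verts n" "Primed (n+1) \<in> chain_verts n"
    "Plain (n+2) \<notin> chain_verts n" "Primed (n+2) \<notin> chain_verts n"
    "Plain (n+1) \<noteq> Primed (n+1)" "Plain (n+2) \<noteq> Primed (n+2)"
    by (auto simp: chain_verts_def)
  note steps = card_linked_step[OF this chain_edges_subset finite_chain_edges]
    card_unlinked_step[OF this chain_edges_subset finite_chain_edges]
  show "num_linked (Suc n) = 8 * num_linked n + 8 * num_unlinked n"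
    "num_unlinked (Suc n) = 4 * num_linked n + 4 * num_unlinked n"
    using steps by (simp_all add: num_linked_def num_unlinked_def chain_verts_Suc chain_edges_Suc)
qed

lemma conn_empty: "conn {} u v \<longleftrightarrow> u = v"
  by (rule conn_isolated) simp

text \<open>The degenerate chain is the single edge between 1 and 1': the full edge set is linked,
  the empty one unlinked.\<close>

lemma num_0: "num_linked 0 = 1" "num_unlinked 0 = 1"
proof -
  have E: "chain_edges 0 = {(Plain 1, Primed 1)}" and V: "chain_verts 0 = {Plain 1, Primed 1}"
    by (auto simp: chain_edges_def chain_verts_def)
  have fin: "finite (Pow {(Plain 1, Primed 1)})" by simp
  show "num_linked 0 = 1" "num_unlinked 0 = 1"
    unfolding num_linked_def num_unlinked_def E V card_filter_eq_sum[OF fin]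
    by (simp_all add: sum_Pow_insert linked_def unlinked_def covering_def acyc_insert conn_insert
        conn_empty del: sum_of_bool_eq)
qed

text \<open>After one step the linked count is twice the unlinked one, and from then on each step
  multiplies both by 12. The ratio fails at 0, hence the start at \<open>Suc n\<close>.\<close>

lemma num_linked_eq: "num_linked (Suc n) = 2 ^ (2 * n + 4) * 3 ^ n \<and> num_unlinked (Suc n) = 2 ^ (2 * n + 3) * 3 ^ n"
  by (induction n) (simp_all add: num_Suc num_0 power_add)

section \<open>Translation between symmetric digraphs and edge sets\<close>

lemma pcas_distinct_avoids:
  assumes "pcas z p w" "distinct (pawalk_verts z p)" "2 \<le> length p"
  shows "(z, w) \<notin> set p" "(w, z) \<notin> set p"
proof -
  have ends: "fst e \<in> set (pawalk_verts u q) \<and> snd e \<in> set (pawalk_verts u q)"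
    if "e \<in> set q" "pcas u q v" for e u v and q :: "('a \<times> 'a) list"
    using that by (induction q arbitrary: u) (auto, (metis list.set_intros(1) neq_Nil_conv pawalk_verts.simps pcas.simps prod.sel)+)
  have last: "v \<in> set (pawalk_verts u q)" "u \<in> set (pawalk_verts u q)" if "pcas u q v" for u v and q :: "('a \<times> 'a) list"
    using that by (induction q arbitrary: u) auto
  \<comment> \<open>The nonempty simple tail \<open>p'\<close> ends in \<open>w\<close> and avoids
    \<open>z\<close>. So the first arc does not end in \<open>w\<close>, and no later arc touches
    \<open>z\<close>.\<close>
  obtain z' p' where p: "p = (z, z') # p'" "pcas z' p' w" "z \<notin> set (pawalk_verts z' p')"
      "distinct (pawalk_verts z' p')" "p' \<noteq> []"
    using assms by (cases p; cases "tl p") auto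
  have "z' \<noteq> w"
    using p(2,4,5) last(1) by (cases p') auto
  moreover have "z \<noteq> z'" using p(3) last[OF p(2)] by auto
  moreover have "(z, w) \<notin> set p'" "(w, z) \<notin> set p'"
    using ends[OF _ p(2)] p(3) by fastforce+
  ultimately show "(z, w) \<notin> set p" "(w, z) \<notin> set p"
    by (auto simp: p(1))
qed

lemma reachable_conn:
  assumes "E \<subseteq> V \<times> V" "u \<in> V" "v \<in> V"
  shows "reachable (with_proj \<lparr> pverts = V, parcs = symcl E \<rparr>) u v \<longleftrightarrow> conn E u v"
proof
  assume "conn E u v"
  then have "(u, v) \<in> rtrancl_on V (symcl E)"
    unfolding conn_def
    by (rule rtrancl_consistent_rtrancl_on) (use assms in \<open>auto simp: symcl_iff\<close>)
  then show "reachable (with_proj \<lparr> pverts = V, parcs = symcl E \<rparr>) u v"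
    by (simp add: reachable_def)
qed (auto simp: reachable_def conn_def dest: rtrancl_on_rtranclI)

lemma pair_graph_symcl:
  assumes "finite V" "E \<subseteq> V \<times> V" "\<And>u v. (u, v) \<in> E \<Longrightarrow> (v, u) \<notin> E"
  shows "pair_graph \<lparr> pverts = V, parcs = symcl E \<rparr>"
proof
  show "finite (parcs \<lparr> pverts = V, parcs = symcl E \<rparr>)"
    using assms(1,2) finite_subset[OF assms(2)] by (simp add: symcl_def)
  show "symmetric (with_proj \<lparr> pverts = V, parcs = symcl E \<rparr>)"
    by (simp add: symmetric_def sym_symcl)
qed (use assms in \<open>fastforce simp: symcl_iff\<close>)+

text \<open>A cycle of length at least 3 is an edge together with a simple path between its ends
  that avoids this edge in both directions; such a path exists exactly when the edge is not a
  bridge.\<close>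

lemma undirected_forest_symcl:
  assumes "finite V" "E \<subseteq> V \<times> V" and asym: "\<And>u v. (u, v) \<in> E \<Longrightarrow> (v, u) \<notin> E"
  shows "undirected_forest \<lparr> pverts = V, parcs = symcl E \<rparr> \<longleftrightarrow> acyc E"
proof -
  let ?G = "\<lambda>E. \<lparr> pverts = V, parcs = symcl E \<rparr>"
  have pg: "pair_graph (?G F)" if "F \<subseteq> E" for F
    using assms that by (intro pair_graph_symcl) blast+
  interpret G: pair_graph "?G E" by (rule pg) simp
  \<comment> \<open>By asymmetry, deleting the one stored arc removes both directions of the edge
    from the symmetric closure.\<close>
  have del: "symcl (E - {(u, v)}) = symcl E - {(u, v), (v, u)}" if "(u, v) \<in> E" for u v
    using asym that by (auto simp: symcl_iff)
  have "(\<exists>p. G.cycle p \<and> 3 \<le> length p) \<longleftrightarrow> \<not> acyc E"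
  proof
    assume "\<exists>p. G.cycle p \<and> 3 \<le> length p"
    then obtain w p where p: "G.awalk w p w" "distinct (tl (pawalk_verts w p))" "3 \<le> length p"
      unfolding G.cycle_def by auto
    then obtain z q where q: "p = (w, z) # q" "(w, z) \<in> symcl E" "G.awalk z q w"
        "distinct (pawalk_verts z q)" "2 \<le> length q"
      by (cases p) (auto simp: G.awalk_Cons_iff)
    then have qc: "pcas z q w" "set q \<subseteq> symcl E" by (auto simp: G.awalk_def)
    \<comment> \<open>Here the length bound enters: the closed walk \<open>w, z, w\<close> would
      return along the same edge, whereas a simple path of at least two arcs cannot use it.\<close>
    then have sub: "set q \<subseteq> symcl E - {(w, z), (z, w)}"
      using pcas_distinct_avoids[OF qc(1) q(4,5)] by auto
    have walk: "(u, v) \<in> R\<^sup>*" if "pcas u r v" "set r \<subseteq> R" for u v r and R :: "'a rel"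
      using that by (induction r arbitrary: u) (auto intro: converse_rtrancl_into_rtrancl)
    have zw: "(z, w) \<in> (symcl E - {(w, z), (z, w)})\<^sup>*"
      using qc(1) sub by (rule walk)
    from q(2) consider "(w, z) \<in> E" | "(z, w) \<in> E" by (auto simp: symcl_iff)
    then show "\<not> acyc E"
    proof cases
      case 1
      then have "conn (E - {(w, z)}) w z"
        using zw by (intro conn_sym[of _ z]) (simp add: conn_def del)
      then show ?thesis using 1 by (auto simp: acyc_def)
    next
      case 2
      then have "conn (E - {(z, w)}) z w"
        using zw by (simp add: conn_def del insert_commute)
      then show ?thesis using 2 by (auto simp: acyc_def)
    qed
  next
    assume "\<not> acyc E"
    then obtain u v where uv: "(u, v) \<in> E" "conn (E - {(u, v)}) u v"
      by (auto simp: acyc_def)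
    interpret D: pair_graph "?G (E - {(u, v)})" by (rule pg) auto
    have uvV: "u \<in> V" "v \<in> V" "u \<noteq> v" using uv assms by auto
    have "reachable (with_proj (?G (E - {(u, v)}))) v u"
      using uv uvV assms(2) by (subst reachable_conn) (auto intro: conn_sym)
    then obtain p where p: "D.apath v p u" by (auto simp: D.reachable_apath)
    then have pc: "pcas v p u" "set p \<subseteq> symcl E - {(u, v), (v, u)}" "distinct (pawalk_verts v p)"
      using del[OF uv(1)] unfolding D.apath_def D.awalk_def by auto
    have "G.cycle ((u, v) # p)"
      unfolding G.cycle_def using pc uv uvV
      by (intro exI[of _ u]) (auto simp: G.awalk_def symcl_iff)
    \<comment> \<open>The return path is not empty because \<open>u\<close> and \<open>v\<close>
      differ, and it is not the single arc \<open>(v, u)\<close> because that arc was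
      deleted.\<close>
    moreover have "3 \<le> length ((u, v) # p)"
    proof -
      have "p \<noteq> []" "tl p \<noteq> []"
        using pc uvV by (cases p; auto)+
      then show ?thesis by (cases p; cases "tl p") auto
    qed
    ultimately show "\<exists>p. G.cycle p \<and> 3 \<le> length p" by blast
  qed
  then show ?thesis
    using G.pair_graph by (simp add: undirected_forest_def)
qed

lemma connected_symcl:
  assumes "E \<subseteq> V \<times> V"
  shows "connected (with_proj \<lparr> pverts = V, parcs = symcl E \<rparr>) \<longleftrightarrow>
     V \<noteq> {} \<and> (\<forall>u\<in>V. \<forall>v\<in>V. conn E u v)"
proof -
  have "mk_symmetric (with_proj \<lparr> pverts = V, parcs = symcl E \<rparr>) = \<lparr> pverts = V, parcs = symcl E \<rparr>"
    by (auto simp: mk_symmetric_def symcl_iff)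
  then show ?thesis
    using assms by (simp add: connected_def strongly_connected_def reachable_conn)
qed

lemma undirected_spanning_tree_crossed_chain:
  assumes "A \<subseteq> chain_edges n"
  shows "undirected_spanning_tree \<lparr> pverts = chain_verts n, parcs = symcl A \<rparr> (crossed_chain n) \<longleftrightarrow>
    linked (chain_verts n) (Plain (n+1)) (Primed (n+1)) A"
proof -
  have V: "finite (chain_verts n)" "Plain (n+1) \<in> chain_verts n" "Primed (n+1) \<in> chain_verts n"
    by (auto simp: chain_verts_def)
  have A: "A \<subseteq> chain_verts n \<times> chain_verts n" using assms chain_edges_subset by blast
  have asym: "(u, v) \<in> A \<Longrightarrow> (v, u) \<notin> A" for u v using assms chain_edges_asym by blast
  have wf: "wf_digraph (with_proj G)" if "pair_graph G" for G :: "chain_vertex pair_pre_digraph"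
  proof -
    interpret pair_graph G by fact
    show ?thesis by (rule wf_digraph)
  qed
  have "spanning (with_proj \<lparr> pverts = chain_verts n, parcs = symcl A \<rparr>) (with_proj (crossed_chain n))"
    using wf[OF pair_graph_crossed_chain] wf[OF pair_graph_symcl[OF V(1) A asym]] symcl_mono[OF assms]
    by (auto simp: spanning_def subgraph_def crossed_chain_eq)
  \<comment> \<open>When the two roots are joined, covering puts every vertex into their common
    component.\<close>
  moreover have "(\<forall>u\<in>chain_verts n. \<forall>v\<in>chain_verts n. conn A u v) \<longleftrightarrow>
      covering (chain_verts n) (Plain (n+1)) (Primed (n+1)) A \<and> conn A (Plain (n+1)) (Primed (n+1))"
    using V unfolding covering_def by (metis conn_sym conn_trans)
  ultimately show ?thesis
    using V by (auto simp: undirected_spanning_tree_def undirected_tree_def linked_def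
        connected_symcl[OF A] undirected_forest_symcl[OF V(1) A asym])
qed

text \<open>Symmetric closure is a bijection from the linked subsets of \<open>chain_edges n\<close>
  onto the spanning trees.\<close>

lemma num_spanning_trees_crossed_chain: "\<tau> (crossed_chain n) = num_linked n"
proof -
  let ?H = "\<lambda>A. \<lparr> pverts = chain_verts n, parcs = symcl A \<rparr>"
  let ?L = "{A \<in> Pow (chain_edges n). linked (chain_verts n) (Plain (n+1)) (Primed (n+1)) A}"
  have "inj_on ?H (Pow (chain_edges n))"
  proof (rule inj_onI)
    fix A B assume AB: "A \<in> Pow (chain_edges n)" "B \<in> Pow (chain_edges n)" "?H A = ?H B"
    \<comment> \<open>The reversed arcs added by the closure lie outside
      \<open>chain_edges n\<close>, so intersecting recovers \<open>C\<close>.\<close>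
    have *: "symcl C \<inter> chain_edges n = C" if "C \<in> Pow (chain_edges n)" for C
      using that chain_edges_asym by (fastforce simp: symcl_iff)
    from AB show "A = B" using *[OF AB(1)] *[OF AB(2)] by (metis pair_pre_digraph.ext_inject)
  qed
  then have "inj_on ?H ?L" by (rule inj_on_subset) blast
  moreover have "{H. undirected_spanning_tree H (crossed_chain n)} = ?H ` ?L"
  proof (intro subset_antisym subsetI)
    fix H assume "H \<in> {H. undirected_spanning_tree H (crossed_chain n)}"
    then have H: "undirected_spanning_tree H (crossed_chain n)" by simp
    then have pg: "pair_graph H" and sub: "parcs H \<subseteq> symcl (chain_edges n)"
      and V: "pverts H = chain_verts n"
      by (auto simp: undirected_spanning_tree_def undirected_tree_def undirected_forest_def
          spanning_def subgraph_def crossed_chain_eq)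
    interpret pair_graph H by fact
    \<comment> \<open>A spanning tree is symmetric, so its arcs in the chosen orientation determine
      it.\<close>
    have "parcs H = symcl (parcs H \<inter> chain_edges n)"
      using sub arcs_symmetric by (auto simp: symcl_iff)
    then have eq: "H = ?H (parcs H \<inter> chain_edges n)" using V by simp
    have "linked (chain_verts n) (Plain (n+1)) (Primed (n+1)) (parcs H \<inter> chain_edges n)"
      using H eq undirected_spanning_tree_crossed_chain[of "parcs H \<inter> chain_edges n" n] by simp
    then show "H \<in> ?H ` ?L" using eq by blast
  qed (auto simp: undirected_spanning_tree_crossed_chain)
  ultimately show ?thesis
    unfolding num_spanning_trees_def num_linked_def
    by (simp only: card_image)
qed

theorem theorem3p3:
  fixes n :: nat
  assumes "n \<ge> 1"
  shows "\<tau> (crossed_chain n) = 2 ^ (2 * n + 2) * 3 ^ (n - 1)"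
proof -
  from assms obtain m where "n = Suc m" by (cases n) auto
  then show ?thesis
    using num_linked_eq[of m] by (simp add: num_spanning_trees_crossed_chain power_add)
qed

end
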